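(* Consider a random walk $P$ in the quarter-plane and its invariant measure $m$, where $m(i,j)=\sum_{(\rho,\sigma)\in\Gamma}\alpha(\rho,\sigma)\rho^i\sigma^j$ for all $(i,j)\in\mathbb{N}_0^2$, with $\Gamma\subset C$ finite and $\alpha(\rho,\sigma)\in\mathbb{R}\setminus\{0\}$ for all $(\rho,\sigma)\in\Gamma$. If $\Gamma$ is a pairwise-coupled set containing only non-degenerate geometric terms (i.e. $\rho>0$ and $\sigma>0$ for every $(\rho,\sigma)\in\Gamma$), then at least one of the coefficients $\alpha(\rho,\sigma)$, $(\rho,\sigma)\in\Gamma$, is negative.
   Context: Random walk in the quarter-plane: a discrete-time Markov chain on $S=\mathbb{N}_0\times\mathbb{N}_0$ determined by non-negative parameters $p_{s,t}$, $h_s$, $v_t$ ($s,t\in\{-1,0,1\}$) with the following transitions. From $(i,j)$ with $i>0,j>0$: to $(i+s,j+t)$ with probability $p_{s,t}$. From $(i,0)$ with $i>0$: to $(i+s,0)$ with probability $h_s$ and to $(i+s,1)$ with probability $p_{s,1}$. From $(0,j)$ with $j>0$: to $(0,j+t)$ with probability $v_t$ and to $(1,j+t)$ with probability $p_{1,t}$. From $(0,0)$: to $(1,0)$ with probability $h_1$, to $(0,1)$ with probability $v_1$, to $(1,1)$ with probability $p_{1,1}$, and to $(0,0)$ with the remaining probability $1-h_1-v_1-p_{1,1}\ge 0$. (Transition probabilities out of each state sum to 1.) The chain is assumed irreducible, aperiodic and positive recurrent. Invariant measure: the (up to a multiplicative constant unique) positive measure $m$ on $S$ satisfying, for all $i>0$,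 $j>0$, $m(i,j)=\sum_{s=-1}^{1}\sum_{t=-1}^{1}m(i-s,j-t)p_{s,t}$, $m(i,0)=\sum_{s=-1}^{1}m(i-s,1)p_{s,-1}+\sum_{s=-1}^{1}m(i-s,0)h_s$, $m(0,j)=\sum_{t=-1}^{1}m(1,j-t)p_{-1,t}+\sum_{t=-1}^{1}m(0,j-t)v_t$ (the balance equation at the origin is implied by these). $C=\{(\rho,\sigma)\in[0,1)^2 : Q(\rho,\sigma)=0\}$, where $Q(\rho,\sigma)=\rho\sigma\left(\sum_{s=-1}^{1}\sum_{t=-1}^{1}\rho^{-s}\sigma^{-t}p_{s,t}-1\right)$, regarded as a polynomial. Uncoupled partition: a partition $\{\Gamma_1,\Gamma_2,\dots\}$ of $\Gamma$ is uncoupled if, whenever $(\rho,\sigma)\in\Gamma_p$ and $(\tilde\rho,\tilde\sigma)\in\Gamma_q$ with $p\ne q$, both $\tilde\rho\ne\rho$ and $\tilde\sigma\ne\sigma$. The maximal uncoupled partition is the uncoupled partition with the largest number of sets (it is unique). A set $\Gamma\subset C$ is pairwise-coupled if and only if its maximal uncoupled partition contains only one set.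
   Formalization: Adds that Γ has at least two elements: a singleton Γ is pairwise-coupled by the stated definition, and a product-form walk such as m(i,j)=(1/2)^i(1/2)^j gives a single positive coefficient, so the claim fails for one term. *)

theory Defs
  imports "HOL-Probability.Probability" "HOL-Library.Disjoint_Sets" "HOL-Library.Equipollence"
begin

section \<open>Discrete-time Markov chains given by a transition kernel\<close>

primrec n_step :: "('a \<Rightarrow> 'a pmf) \<Rightarrow> nat \<Rightarrow> 'a \<Rightarrow> 'a pmf" where
  "n_step K 0 x = return_pmf x"
| "n_step K (Suc n) x = bind_pmf (K x) (n_step K n)"

definition irreducible_chain :: "('a \<Rightarrow> 'a pmf) \<Rightarrow> bool" where
  "irreducible_chain K \<longleftrightarrow> (\<forall>x y. \<exists>n. pmf (n_step K n x) y > 0)"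

definition aperiodic_chain :: "('a \<Rightarrow> 'a pmf) \<Rightarrow> bool" where
  "aperiodic_chain K \<longleftrightarrow> (\<forall>x. Gcd {n::nat. n > 0 \<and> pmf (n_step K n x) x > 0} = 1)"

text \<open>
  Probability that the chain started in \<open>x\<close> visits \<open>y\<close> at time \<open>n\<close> and at no time
  in \<open>{1..<n}\<close>; for \<open>x = y\<close> this is the distribution of the first return time.
\<close>
fun first_passage :: "('a \<Rightarrow> 'a pmf) \<Rightarrow> 'a \<Rightarrow> nat \<Rightarrow> 'a \<Rightarrow> real" where
  "first_passage K y 0 x = 0"
| "first_passage K y (Suc 0) x = pmf (K x) y"
| "first_passage K y (Suc (Suc n)) x =
     measure_pmf.expectation (K x) (\<lambda>z. if z = y then 0 else first_passage K y (Suc n) z)"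

text \<open>The return time to every state is almost surely finite and has finite mean.\<close>
definition positive_recurrent_chain :: "('a \<Rightarrow> 'a pmf) \<Rightarrow> bool" where
  "positive_recurrent_chain K \<longleftrightarrow>
     (\<forall>y. (\<lambda>n. first_passage K y n y) sums 1 \<and>
          summable (\<lambda>n. real n * first_passage K y n y))"

section \<open>Random walks in the quarter-plane\<close>

text \<open>The parameters \<open>p s t\<close>, \<open>h s\<close>, \<open>v t\<close> are only relevant for \<open>s, t \<in> {-1..1}\<close>.\<close>

definition qp_params :: "(int \<Rightarrow> int \<Rightarrow> real) \<Rightarrow> (int \<Rightarrow> real) \<Rightarrow> (int \<Rightarrow> real) \<Rightarrow> bool" where
  "qp_params p h v \<longleftrightarrow>
     (\<forall>s\<in>{-1..1}. \<forall>t\<in>{-1..1}. p s t \<ge> 0) \<and>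
     (\<forall>s\<in>{-1..1}. h s \<ge> 0) \<and>
     (\<forall>t\<in>{-1..1}. v t \<ge> 0) \<and>
     (\<Sum>s=-1..1. \<Sum>t=-1..1. p s t) = 1 \<and>
     (\<Sum>s=-1..1. h s) + (\<Sum>s=-1..1. p s 1) = 1 \<and>
     (\<Sum>t=-1..1. v t) + (\<Sum>t=-1..1. p 1 t) = 1 \<and>
     1 - h 1 - v 1 - p 1 1 \<ge> 0"

text \<open>Since the target \<open>(k, l)\<close> lies in the quarter-plane, \<open>j = 0\<close> forces \<open>t \<ge> 0\<close> and
  \<open>i = 0\<close> forces \<open>s \<ge> 0\<close> for the increment \<open>(s, t)\<close>.\<close>
fun qp_trans :: "(int \<Rightarrow> int \<Rightarrow> real) \<Rightarrow> (int \<Rightarrow> real) \<Rightarrow> (int \<Rightarrow> real) \<Rightarrow>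
    nat \<times> nat \<Rightarrow> nat \<times> nat \<Rightarrow> real" where
  "qp_trans p h v (i, j) (k, l) =
     (let s = int k - int i; t = int l - int j in
      if s \<notin> {-1..1} \<or> t \<notin> {-1..1} then 0
      else if i > 0 \<and> j > 0 then p s t
      else if i > 0 then (if t = 0 then h s else p s 1)
      else if j > 0 then (if s = 0 then v t else p 1 t)
      else if s = 1 \<and> t = 0 then h 1
      else if s = 0 \<and> t = 1 then v 1
      else if s = 1 \<and> t = 1 then p 1 1
      else 1 - h 1 - v 1 - p 1 1)"

definition qp_kernel :: "(int \<Rightarrow> int \<Rightarrow> real) \<Rightarrow> (int \<Rightarrow> real) \<Rightarrow> (int \<Rightarrow> real) \<Rightarrow>
    nat \<times> nat \<Rightarrow> (nat \<times> nat) pmf" where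
  "qp_kernel p h v x = embed_pmf (qp_trans p h v x)"

lemma atLeastAtMost_m1_1: "{-1..1::int} = {-1, 0, 1}"
  by auto

lemma qp_trans_nonneg:
  assumes "qp_params p h v"
  shows "qp_trans p h v x y \<ge> 0"
  using assms by (cases x; cases y) (auto simp: qp_params_def Let_def)

lemma qp_trans_sum:
  assumes "qp_params p h v"
  shows "\<exists>F. finite F \<and> (\<forall>y. y \<notin> F \<longrightarrow> qp_trans p h v x y = 0) \<and> (\<Sum>y\<in>F. qp_trans p h v x y) = 1"
proof -
  obtain i j where x: "x = (i, j)" by (cases x)
  define I where "I = (\<lambda>n::nat. if n = 0 then {0, 1} else {n - 1, n, n + 1})"
  have fin: "finite (I i \<times> I j)" by (auto simp: I_def)
  have out: "\<forall>y. y \<notin> I i \<times> I j \<longrightarrow> qp_trans p h v x y = 0"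
    by (auto simp: x I_def Let_def split: if_splits)
  have one: "(\<Sum>y\<in>I i \<times> I j. qp_trans p h v x y) = 1"
  proof (cases i; cases j)
    assume "i = 0" "j = 0"
    then show ?thesis
      by (simp add: x I_def sum.cartesian_product[symmetric] Let_def)
  next
    fix b assume "i = 0" "j = Suc b"
    then show ?thesis using assms
      by (simp add: x I_def sum.cartesian_product[symmetric] Let_def qp_params_def
          atLeastAtMost_m1_1)
  next
    fix a assume "i = Suc a" "j = 0"
    then show ?thesis using assms
      by (simp add: x I_def sum.cartesian_product[symmetric] Let_def qp_params_def
          atLeastAtMost_m1_1)
  next
    fix a b assume "i = Suc a" "j = Suc b"
    then show ?thesis using assms
      by (simp add: x I_def sum.cartesian_product[symmetric] Let_def qp_params_def
          atLeastAtMost_m1_1)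
  qed
  show ?thesis using fin out one by blast
qed

lemma pmf_qp_kernel:
  assumes "qp_params p h v"
  shows "pmf (qp_kernel p h v x) y = qp_trans p h v x y"
proof -
  obtain F where F: "finite F" "\<forall>y. y \<notin> F \<longrightarrow> qp_trans p h v x y = 0"
    "(\<Sum>y\<in>F. qp_trans p h v x y) = 1"
    using qp_trans_sum[OF assms] by blast
  have nn: "\<And>y. qp_trans p h v x y \<ge> 0" by (rule qp_trans_nonneg[OF assms])
  have "(\<integral>\<^sup>+ y. ennreal (qp_trans p h v x y) \<partial>count_space UNIV) =
        (\<Sum>y\<in>F. ennreal (qp_trans p h v x y))"
    by (rule nn_integral_count_space') (use F in auto)
  also have "\<dots> = ennreal (\<Sum>y\<in>F. qp_trans p h v x y)"
    by (rule sum_ennreal) (rule nn)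
  finally have "(\<integral>\<^sup>+ y. ennreal (qp_trans p h v x y) \<partial>count_space UNIV) = 1"
    using F by simp
  then show ?thesis
    unfolding qp_kernel_def by (intro pmf_embed_pmf nn)
qed

definition qp_random_walk :: "(int \<Rightarrow> int \<Rightarrow> real) \<Rightarrow> (int \<Rightarrow> real) \<Rightarrow> (int \<Rightarrow> real) \<Rightarrow> bool" where
  "qp_random_walk p h v \<longleftrightarrow>
     qp_params p h v \<and>
     irreducible_chain (qp_kernel p h v) \<and>
     aperiodic_chain (qp_kernel p h v) \<and>
     positive_recurrent_chain (qp_kernel p h v)"

text \<open>All arguments of \<^const>\<open>nat\<close> below are non-negative, so nothing is truncated.\<close>
definition invariant_measure :: "(int \<Rightarrow> int \<Rightarrow> real) \<Rightarrow> (int \<Rightarrow> real) \<Rightarrow> (int \<Rightarrow> real) \<Rightarrow>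
    (nat \<Rightarrow> nat \<Rightarrow> real) \<Rightarrow> bool" where
  "invariant_measure p h v m \<longleftrightarrow>
     (\<forall>i j. m i j > 0) \<and>
     (\<forall>i>0. \<forall>j>0. m i j =
        (\<Sum>s=-1..1. \<Sum>t=-1..1. m (nat (int i - s)) (nat (int j - t)) * p s t)) \<and>
     (\<forall>i>0. m i 0 =
        (\<Sum>s=-1..1. m (nat (int i - s)) 1 * p s (-1)) +
        (\<Sum>s=-1..1. m (nat (int i - s)) 0 * h s)) \<and>
     (\<forall>j>0. m 0 j =
        (\<Sum>t=-1..1. m 1 (nat (int j - t)) * p (-1) t) +
        (\<Sum>t=-1..1. m 0 (nat (int j - t)) * v t))"

section \<open>Geometric terms and coupling\<close>

text \<open>The factor \<open>\<rho> \<sigma>\<close> is multiplied into the sum \<open>\<Sum>s t. \<rho>\<^sup>-\<^sup>s \<sigma>\<^sup>-\<^sup>t p s t\<close>, so that \<open>qp_Q\<close> is a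
  polynomial also at \<open>\<rho> = 0\<close> or \<open>\<sigma> = 0\<close>.\<close>
definition qp_Q :: "(int \<Rightarrow> int \<Rightarrow> real) \<Rightarrow> real \<Rightarrow> real \<Rightarrow> real" where
  "qp_Q p \<rho> \<sigma> =
     (\<Sum>s=-1..1. \<Sum>t=-1..1. \<rho> ^ nat (1 - s) * \<sigma> ^ nat (1 - t) * p s t) - \<rho> * \<sigma>"

definition qp_C :: "(int \<Rightarrow> int \<Rightarrow> real) \<Rightarrow> (real \<times> real) set" where
  "qp_C p = {(\<rho>, \<sigma>). 0 \<le> \<rho> \<and> \<rho> < 1 \<and> 0 \<le> \<sigma> \<and> \<sigma> < 1 \<and> qp_Q p \<rho> \<sigma> = 0}"

definition uncoupled_partition :: "(real \<times> real) set \<Rightarrow> (real \<times> real) set set \<Rightarrow> bool" where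
  "uncoupled_partition \<Gamma> \<P> \<longleftrightarrow>
     partition_on \<Gamma> \<P> \<and>
     (\<forall>A\<in>\<P>. \<forall>B\<in>\<P>. A \<noteq> B \<longrightarrow>
        (\<forall>(\<rho>, \<sigma>)\<in>A. \<forall>(\<rho>', \<sigma>')\<in>B. \<rho>' \<noteq> \<rho> \<and> \<sigma>' \<noteq> \<sigma>))"

text \<open>The number of blocks is compared by \<^const>\<open>lepoll\<close> because \<^const>\<open>card\<close> vanishes on infinite
  sets; for finite \<open>\<Gamma>\<close> this is the comparison of cardinalities.\<close>
definition maximal_uncoupled_partition ::
    "(real \<times> real) set \<Rightarrow> (real \<times> real) set set \<Rightarrow> bool" where
  "maximal_uncoupled_partition \<Gamma> \<P> \<longleftrightarrow>
     uncoupled_partition \<Gamma> \<P> \<and> (\<forall>\<Q>. uncoupled_partition \<Gamma> \<Q> \<longrightarrow> \<Q> \<lesssim> \<P>)"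

definition pairwise_coupled :: "(real \<times> real) set \<Rightarrow> bool" where
  "pairwise_coupled \<Gamma> \<longleftrightarrow> (\<exists>\<P>. maximal_uncoupled_partition \<Gamma> \<P> \<and> card \<P> = 1)"

end

theory Submission
  imports Defs
begin

text \<open>
  Put \<open>\<rho> = exp (-x)\<close> and \<open>\<sigma> = exp (-y)\<close>. Then \<open>Q = 0\<close> becomes \<open>F x y = 1\<close> for the convex function
  \<open>F = kernel_fun p\<close>, and the points of \<open>\<Gamma>\<close> lie in the open positive quadrant. By linear independence
  of the powers of distinct \<open>\<sigma>\<close>, the balance equation on the vertical axis says that the sum of
  \<open>\<alpha> * V x y\<close> over the points of \<open>\<Gamma>\<close> with the same \<open>y\<close> vanishes, where \<open>V = boundary_fun p v\<close> is convex
  and decreasing in \<open>x\<close>; likewise on the horizontal axis. If all \<open>\<alpha>\<close> were positive, then \<open>V\<close> would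
  vanish at a point alone on its horizontal line and change sign on every other one on which it is
  not identically zero.

  Consider the points with the smallest \<open>y\<close>. If there are two of them, the left one cannot have
  another point above it, by convexity of \<open>{F \<le> 1}\<close>, which contains the origin; so it is alone on its
  vertical line. Up to exchanging the axes there is thus a point \<open>(x, y)\<close> alone on its horizontal
  line with a point \<open>(x, y')\<close> above it. Since \<open>F x 0 - 1 = - (exp x - 1) * V x 0\<close> and \<open>F x 0 > 1\<close>,
  \<open>V\<close> is negative at \<open>(x, 0)\<close>, zero at \<open>(x, y)\<close>, hence positive at \<open>(x, y')\<close>, hence negative at some
  \<open>(w, y')\<close> in \<open>\<Gamma>\<close>. The segment from \<open>(w, y')\<close> to the zero of \<open>F - 1\<close> and \<open>V\<close> on the horizontal axis
  meets height \<open>y\<close> in a point of \<open>{F \<le> 1}\<close> with \<open>V < 0\<close>, that is, to the right of \<open>x\<close>, which the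
  convexity of \<open>{F \<le> 1}\<close> excludes as before.
\<close>

section \<open>Convexity of the kernel and boundary functions\<close>

definition kernel_fun :: "(int \<Rightarrow> int \<Rightarrow> real) \<Rightarrow> real \<Rightarrow> real \<Rightarrow> real" where
  "kernel_fun p x y = (\<Sum>s=-1..1. \<Sum>t=-1..1. p s t * exp (of_int s * x + of_int t * y))"

text \<open>The defect of the balance equation on the vertical axis at the term
  \<open>\<rho>^i * \<sigma>^j\<close>, divided by \<open>\<sigma>^j\<close>, where
  \<open>\<rho> = exp (-x)\<close> and \<open>\<sigma> = exp (-y)\<close>.\<close>

definition boundary_fun :: "(int \<Rightarrow> int \<Rightarrow> real) \<Rightarrow> (int \<Rightarrow> real) \<Rightarrow> real \<Rightarrow> real \<Rightarrow> real" where
  "boundary_fun p v x y =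
     (\<Sum>t=-1..1. p (-1) t * exp (of_int t * y - x)) + (\<Sum>t=-1..1. v t * exp (of_int t * y)) - 1"

text \<open>Records what a vanishing sum of \<open>boundary_fun\<close> with positive weights along
  each horizontal line says about signs, without mentioning the weights.\<close>

definition sign_balanced ::
    "(int \<Rightarrow> int \<Rightarrow> real) \<Rightarrow> (int \<Rightarrow> real) \<Rightarrow> (real \<times> real) set \<Rightarrow> bool" where
  "sign_balanced p v G \<longleftrightarrow> (\<forall>x y. (x, y) \<in> G \<longrightarrow>
     (boundary_fun p v x y > 0 \<longrightarrow> (\<exists>x'. (x', y) \<in> G \<and> boundary_fun p v x' y < 0)) \<and>
     (boundary_fun p v x y < 0 \<longrightarrow> (\<exists>x'. (x', y) \<in> G \<and> boundary_fun p v x' y > 0)))"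

text \<open>Only one axis is involved, so that exchanging the axes is an instance: \<open>p\<close>
  transposed and \<open>h\<close> in place of \<open>v\<close>.\<close>

definition quarter_plane_boundary :: "(int \<Rightarrow> int \<Rightarrow> real) \<Rightarrow> (int \<Rightarrow> real) \<Rightarrow> bool" where
  "quarter_plane_boundary p v \<longleftrightarrow>
     (\<forall>s\<in>{-1..1}. \<forall>t\<in>{-1..1}. p s t \<ge> 0) \<and> (\<forall>t\<in>{-1..1}. v t \<ge> 0) \<and>
     (\<Sum>s=-1..1. \<Sum>t=-1..1. p s t) = 1 \<and> (\<Sum>t=-1..1. v t) + (\<Sum>t=-1..1. p 1 t) = 1"

definition vertical_moves :: "(int \<Rightarrow> int \<Rightarrow> real) \<Rightarrow> bool" where
  "vertical_moves p \<longleftrightarrow> (\<exists>s\<in>{-1..1}. p s 1 \<noteq> 0 \<or> p s (-1) \<noteq> 0)"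

lemma exp_convex_combination:
  fixes a b u :: real
  assumes "0 \<le> u" "u \<le> 1"
  shows "exp ((1 - u) * a + u * b) \<le> (1 - u) * exp a + u * exp b"
  using convex_onD[OF exp_convex, of u a b] assms by simp

lemma exp_affine_convex:
  fixes u :: real
  assumes "0 \<le> u" "u \<le> 1"
  shows "exp (c * ((1 - u) * a + u * a') + d * ((1 - u) * b + u * b'))
    \<le> (1 - u) * exp (c * a + d * b) + u * exp (c * a' + d * b')"
  using exp_convex_combination[OF assms, of "c * a + d * b" "c * a' + d * b'"]
  by (simp add: algebra_simps)

lemma kernel_fun_convex:
  assumes "quarter_plane_boundary p v" "0 \<le> u" "u \<le> 1"
  shows "kernel_fun p ((1 - u) * a + u * a') ((1 - u) * b + u * b')
    \<le> (1 - u) * kernel_fun p a b + u * kernel_fun p a' b'"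
proof -
  have "kernel_fun p ((1 - u) * a + u * a') ((1 - u) * b + u * b') \<le>
    (\<Sum>s=-1..1. \<Sum>t=-1..1. p s t *
       ((1 - u) * exp (of_int s * a + of_int t * b) + u * exp (of_int s * a' + of_int t * b')))"
    unfolding kernel_fun_def using assms
    by (intro sum_mono mult_left_mono exp_affine_convex)
       (auto simp: quarter_plane_boundary_def)
  also have "\<dots> = (1 - u) * kernel_fun p a b + u * kernel_fun p a' b'"
    by (simp add: kernel_fun_def atLeastAtMost_m1_1 algebra_simps)
  finally show ?thesis .
qed

lemma boundary_fun_convex:
  assumes "quarter_plane_boundary p v" "0 \<le> u" "u \<le> 1"
  shows "boundary_fun p v ((1 - u) * a + u * a') ((1 - u) * b + u * b')
    \<le> (1 - u) * boundary_fun p v a b + u * boundary_fun p v a' b'"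
proof -
  have p: "p (-1) t \<ge> 0" "v t \<ge> 0" if "t \<in> {-1..1}" for t
    using assms(1) that by (auto simp: quarter_plane_boundary_def)
  have "(\<Sum>t=-1..1. p (-1) t * exp (of_int t * ((1 - u) * b + u * b') - ((1 - u) * a + u * a')))
    \<le> (\<Sum>t=-1..1. p (-1) t * ((1 - u) * exp (of_int t * b - a) + u * exp (of_int t * b' - a')))"
    using exp_affine_convex[OF assms(2,3), of "of_int _" b b' "-1" a a'] p
    by (intro sum_mono mult_left_mono) (simp_all add: algebra_simps)
  moreover have "(\<Sum>t=-1..1. v t * exp (of_int t * ((1 - u) * b + u * b')))
    \<le> (\<Sum>t=-1..1. v t * ((1 - u) * exp (of_int t * b) + u * exp (of_int t * b')))"
    using exp_affine_convex[OF assms(2,3), of "of_int _" b b' 0 a a'] p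
    by (intro sum_mono mult_left_mono) simp_all
  ultimately show ?thesis
    by (simp add: boundary_fun_def atLeastAtMost_m1_1 algebra_simps)
qed

lemma boundary_fun_antimono:
  assumes "quarter_plane_boundary p v" "x \<le> x'"
  shows "boundary_fun p v x' y \<le> boundary_fun p v x y"
  unfolding boundary_fun_def using assms
  by (intro diff_mono add_mono sum_mono mult_left_mono) (auto simp: quarter_plane_boundary_def)

text \<open>At \<open>y = 0\<close> only the total probabilities \<open>A\<close> of a step to the
  left and \<open>B\<close> of a step to the right matter: \<open>boundary_fun\<close> becomes
  \<open>A * exp (-x) - B\<close>, and the left-hand side
  \<open>A * (exp (-x) - 1) + B * (exp x - 1)\<close>.\<close>

lemma kernel_fun_at_0:
  assumes "quarter_plane_boundary p v"
  shows "kernel_fun p x 0 - 1 = - (exp x - 1) * boundary_fun p v x 0"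
proof -
  have "(exp x - 1) * exp (-x) = 1 - exp (-x)"
    by (simp add: algebra_simps flip: exp_add)
  moreover have "boundary_fun p v x 0 = exp (-x) * (\<Sum>t=-1..1. p (-1) t) - (\<Sum>t=-1..1. p 1 t)"
    using assms unfolding quarter_plane_boundary_def boundary_fun_def
    by (simp add: sum_distrib_left mult.commute)
  moreover have "kernel_fun p x 0 = exp (-x) * (\<Sum>t=-1..1. p (-1) t) + (\<Sum>t=-1..1. p 0 t)
      + exp x * (\<Sum>t=-1..1. p 1 t)"
    by (simp add: kernel_fun_def atLeastAtMost_m1_1 algebra_simps)
  moreover have "(\<Sum>t=-1..1. p (-1) t) + (\<Sum>t=-1..1. p 0 t) + (\<Sum>t=-1..1. p 1 t) = 1"
    using assms by (simp add: quarter_plane_boundary_def atLeastAtMost_m1_1)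
  ultimately show ?thesis by algebra
qed

lemma kernel_fun_0_0:
  assumes "quarter_plane_boundary p v"
  shows "kernel_fun p 0 0 = 1"
  using kernel_fun_at_0[OF assms, of 0] by simp

section \<open>Strict convexity along vertical lines\<close>

text \<open>\<open>A * exp (-y) + C * exp y\<close> is strictly convex unless both coefficients
  vanish. In terms of \<open>exp y\<close>, equality at \<open>M\<close> and \<open>R\<close> gives
  \<open>A = C * M * R\<close>, and the inequality at \<open>L\<close> becomes
  \<open>C * (M - L) * (R - L) \<le> 0\<close>.\<close>

lemma exp_three_points:
  fixes A C :: real
  assumes "A \<ge> 0" "C \<ge> 0" "l < m" "m < r"
    and "A * exp (-l) + C * exp l \<le> k" "A * exp (-m) + C * exp m = k"
    and "A * exp (-r) + C * exp r = k"
  shows "A = 0 \<and> C = 0"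
proof -
  define L M R where "L = exp l" and "M = exp m" and "R = exp r"
  have pos: "0 < L" "L < M" "M < R" using assms by (auto simp: L_def M_def R_def)
  have e: "A / L + C * L \<le> k" "A / M + C * M = k" "A / R + C * R = k"
    using assms(5-) by (simp_all add: L_def M_def R_def exp_minus divide_inverse)
  have "(R - M) * (C * M * R - A) = 0"
    using e(2,3) pos by (simp add: field_simps) algebra
  then have A: "A = C * M * R" using pos by simp
  have "A / L + C * L \<le> A / M + C * M" using e by simp
  then have "C * M * R / L + C * L \<le> C * R + C * M" using pos A by simp
  then have "C * ((M - L) * (R - L)) \<le> 0" using pos by (simp add: field_simps)
  moreover have "(M - L) * (R - L) > 0" using pos by simp
  ultimately have "C = 0" using assms(2) by (metis mult_le_0_iff not_less order_antisym)
  then show ?thesis using A by simp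
qed

text \<open>For fixed \<open>x\<close> the coefficients of \<open>exp y\<close> and
  \<open>exp (-y)\<close> are sums of \<open>p s 1\<close> and \<open>p s (-1)\<close> with positive
  weights, so they both vanish only without vertical moves.\<close>

lemma kernel_fun_three_points:
  assumes "quarter_plane_boundary p v" "vertical_moves p" "l < m" "m < r"
    and "kernel_fun p x l \<le> 1" "kernel_fun p x m = 1" "kernel_fun p x r = 1"
  shows False
proof -
  have nn: "p s t \<ge> 0" if "s \<in> {-1..1}" "t \<in> {-1..1}" for s t
    using assms(1) that by (auto simp: quarter_plane_boundary_def)
  define c where "c t = (\<Sum>s=-1..1. p s t * exp (of_int s * x))" for t
  have F: "kernel_fun p x y = c (-1) * exp (-y) + c 0 + c 1 * exp y" for y
    by (simp add: kernel_fun_def c_def atLeastAtMost_m1_1 algebra_simps exp_add exp_diff exp_minus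
        divide_inverse)
  have "c t \<ge> 0" if "t \<in> {-1..1}" for t
    unfolding c_def using that nn by (intro sum_nonneg mult_nonneg_nonneg) auto
  then have "c (-1) = 0 \<and> c 1 = 0"
    using assms(3-) by (intro exp_three_points[of _ _ l m r "1 - c 0"]) (auto simp: F)
  then have "p s 1 = 0 \<and> p s (-1) = 0" if "s \<in> {-1..1}" for s
    using that nn unfolding c_def by (subst (asm) (1 2) sum_nonneg_eq_0_iff) auto
  then show False using assms(2) by (auto simp: vertical_moves_def)
qed

text \<open>The segment from the origin to \<open>(z, y)\<close> stays where the kernel is at most 1
  and crosses the vertical line through \<open>x\<close> below \<open>y\<close>, which yields three
  points there.\<close>

lemma no_kernel_point_to_the_right:
  assumes "quarter_plane_boundary p v" "vertical_moves p"
    and "0 < x" "x < z" "0 < y" "y < y'"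
    and "kernel_fun p x y = 1" "kernel_fun p x y' = 1" "kernel_fun p z y \<le> 1"
  shows False
proof (rule kernel_fun_three_points[OF assms(1,2), of "x / z * y" y y' x])
  show "x / z * y < y" using assms by (simp add: field_simps)
  have "kernel_fun p ((1 - x / z) * 0 + x / z * z) ((1 - x / z) * 0 + x / z * y)
    \<le> (1 - x / z) * kernel_fun p 0 0 + x / z * kernel_fun p z y"
    using assms by (intro kernel_fun_convex) (auto simp: field_simps)
  also have "\<dots> \<le> (1 - x / z) * 1 + x / z * 1"
    using assms by (intro add_mono mult_left_mono) (auto simp: kernel_fun_0_0)
  finally show "kernel_fun p x (x / z * y) \<le> 1" using assms by simp
qed (use assms in auto)

section \<open>Exclusion of sign-balanced sets\<close>

lemma no_lower_end:
  assumes qp: "quarter_plane_boundary p v" and "vertical_moves p" and bal: "sign_balanced p v G"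
    and pos: "\<And>x y. (x, y) \<in> G \<Longrightarrow> 0 < x \<and> 0 < y \<and> kernel_fun p x y = 1"
    and G: "(x, y) \<in> G" "(x, y') \<in> G" "y < y'"
    and single: "\<And>x'. (x', y) \<in> G \<Longrightarrow> x' = x"
  shows False
proof -
  let ?V = "boundary_fun p v"
  have xy: "0 < x" "0 < y" "kernel_fun p x y = 1" "kernel_fun p x y' = 1"
    using pos G by auto
  \<comment> \<open>Otherwise the heights 0, \<open>y\<close> and \<open>y'\<close> would be three
    forbidden points on one vertical line.\<close>
  have "kernel_fun p x 0 > 1"
    using kernel_fun_three_points[OF assms(1,2) _ G(3), of 0 x] xy by force
  then have "(exp x - 1) * ?V x 0 < 0"
    using kernel_fun_at_0[OF qp, of x] by (simp add: algebra_simps)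
  then have V0: "?V x 0 < 0" using xy by (simp add: mult_less_0_iff)
  have Vy: "?V x y = 0"
    using bal G(1) single unfolding sign_balanced_def by (metis less_asym linorder_less_linear)
  define u where "u = y / y'"
  have u: "0 < u" "u < 1" "u * y' = y" using xy G(3) by (auto simp: u_def field_simps)
  have "?V x y \<le> (1 - u) * ?V x 0 + u * ?V x y'"
    using boundary_fun_convex[OF qp, of u x x 0 y'] u by (simp add: algebra_simps)
  moreover have "(1 - u) * ?V x 0 < 0" using V0 u by (simp add: mult_less_0_iff)
  ultimately have "0 < u * ?V x y'" using Vy by linarith
  then have Vy': "0 < ?V x y'" using u by (simp add: zero_less_mult_iff)
  then obtain w where w: "(w, y') \<in> G" "?V w y' < 0"
    using bal G(2) unfolding sign_balanced_def by blast
  define A B where "A = (\<Sum>t=-1..1. p (-1) t)" and "B = (\<Sum>t=-1..1. p 1 t)"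
  have nn: "p s t \<ge> 0" if "s \<in> {-1..1}" "t \<in> {-1..1}" for s t
    using qp that by (auto simp: quarter_plane_boundary_def)
  have AB: "?V a 0 = exp (-a) * A - B" for a
    using qp unfolding quarter_plane_boundary_def boundary_fun_def A_def B_def
    by (simp add: sum_distrib_left mult.commute)
  have "A \<ge> 0" unfolding A_def using nn by (intro sum_nonneg) auto
  \<comment> \<open>With no steps to the left, \<open>boundary_fun\<close> would not depend on its
    first argument and could not change sign at height \<open>y'\<close>.\<close>
  have "A \<noteq> 0"
  proof
    assume "A = 0"
    then have "p (-1) t = 0" if "t \<in> {-1..1}" for t
      using nn that unfolding A_def by (subst (asm) sum_nonneg_eq_0_iff) auto
    then have "?V w y' = ?V x y'" by (simp add: boundary_fun_def)
    then show False using w Vy' by simp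
  qed
  have "B > 0" using AB[of x] V0 \<open>A \<ge> 0\<close>
    by (smt (verit) exp_gt_zero mult_nonneg_nonneg)
  \<comment> \<open>The zero of \<open>boundary_fun\<close> on the horizontal axis, possibly not
    positive; the kernel is 1 there as well.\<close>
  define a where "a = ln (A / B)"
  have Va: "?V a 0 = 0"
    using \<open>A \<ge> 0\<close> \<open>A \<noteq> 0\<close> \<open>B > 0\<close> unfolding AB a_def exp_minus by (subst exp_ln) auto
  have Fa: "kernel_fun p a 0 = 1" using kernel_fun_at_0[OF qp, of a] Va by simp
  \<comment> \<open>The segment from \<open>(a, 0)\<close> to \<open>(w, y')\<close> has height
    \<open>y\<close> at \<open>z\<close>.\<close>
  define z where "z = (1 - u) * a + u * w"
  have "?V z y \<le> (1 - u) * ?V a 0 + u * ?V w y'"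
    using boundary_fun_convex[OF qp, of u a w 0 y'] u by (simp add: z_def)
  also have "\<dots> < 0" using Va w u by (simp add: mult_less_0_iff)
  finally have "?V z y < ?V x y" using Vy by simp
  then have "x < z" using boundary_fun_antimono[OF qp, of z x y] by linarith
  moreover have "kernel_fun p z y \<le> (1 - u) * kernel_fun p a 0 + u * kernel_fun p w y'"
    using kernel_fun_convex[OF qp, of u a w 0 y'] u by (simp add: z_def)
  then have "kernel_fun p z y \<le> 1" using Fa pos[OF w(1)] by simp
  ultimately show False
    using no_kernel_point_to_the_right[OF assms(1,2)] xy G(3) by blast
qed

text \<open>Without vertical moves \<open>F\<close> is constant in \<open>y\<close>, so strict convexity along vertical lines is lost.
  Then all points lie on one vertical line, on which \<open>V\<close> would vanish at \<open>0\<close> and at two points of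
  \<open>G\<close>, although it is strictly convex there.\<close>
lemma vertical_moves_if_balanced:
  assumes qp: "quarter_plane_boundary p v" and bal: "sign_balanced p v G"
    and pos: "\<And>x y. (x, y) \<in> G \<Longrightarrow> 0 < x \<and> 0 < y \<and> kernel_fun p x y = 1"
    and "z \<in> G" "z' \<in> G" "z \<noteq> z'"
    and moves: "\<exists>s\<in>{-1..1}. \<exists>t\<in>{-1..1}. (s, t) \<noteq> (0, 0) \<and> p s t \<noteq> 0"
    and v: "vertical_moves p \<or> v 1 \<noteq> 0 \<or> v (-1) \<noteq> 0"
  shows "vertical_moves p"
proof (rule ccontr)
  assume nv: "\<not> vertical_moves p"
  let ?V = "boundary_fun p v"
  have nn: "p s t \<ge> 0" "v t \<ge> 0" if "s \<in> {-1..1}" "t \<in> {-1..1}" for s t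
    using qp that by (auto simp: quarter_plane_boundary_def)
  have p0: "p s 1 = 0" "p s (-1) = 0" if "s \<in> {-1..1}" for s
    using nv that by (auto simp: vertical_moves_def)
  have F: "kernel_fun p x y = kernel_fun p x 0" for x y
    using p0 by (simp add: kernel_fun_def atLeastAtMost_m1_1)
  have V: "?V x 0 = 0" if "(x, y) \<in> G" for x y
    using pos[OF that] F[of x y] kernel_fun_at_0[OF qp, of x] by simp
  have V0: "?V x 0 = p (-1) 0 * exp (-x) - p 1 0" for x
    using qp p0 by (simp add: boundary_fun_def quarter_plane_boundary_def atLeastAtMost_m1_1)
  have "p (-1) 0 \<noteq> 0 \<or> p 1 0 \<noteq> 0"
    using moves p0 by (auto simp: atLeastAtMost_m1_1)
  moreover have "p (-1) 0 * exp (- fst z) = p 1 0"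
    using V[of "fst z" "snd z"] V0[of "fst z"] \<open>z \<in> G\<close> by simp
  ultimately have "p (-1) 0 \<noteq> 0" by auto
  \<comment> \<open>\<open>p (-1) 0 * exp (-x)\<close> is injective in \<open>x\<close>, so its
    value \<open>p 1 0\<close> fixes the vertical line.\<close>
  have eq: "x = fst z" if "(x, y) \<in> G" for x y
    using V[OF that] V0[of x] \<open>p (-1) 0 * exp (- fst z) = p 1 0\<close> \<open>p (-1) 0 \<noteq> 0\<close>
    by (metis cancel_comm_monoid_add_class.diff_cancel eq_iff_diff_eq_0 exp_inj_iff
        mult_cancel_left neg_equal_iff_equal)
  define x where "x = fst z"
  have Vy: "?V x y = 0" if "(x, y) \<in> G" for y
    using bal that eq unfolding sign_balanced_def x_def
    by (metis less_asym linorder_less_linear)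
  have "fst z' = x" using eq[of "fst z'" "snd z'"] \<open>z' \<in> G\<close> by (simp add: x_def)
  then have "snd z \<noteq> snd z'" using \<open>z \<noteq> z'\<close> by (auto simp: x_def prod_eq_iff)
  moreover have "(x, snd z) \<in> G" "(x, snd z') \<in> G"
    using \<open>z \<in> G\<close> \<open>z' \<in> G\<close> \<open>fst z' = x\<close> by (metis prod.collapse x_def)+
  ultimately obtain y y' where y: "(x, y) \<in> G" "(x, y') \<in> G" "y < y'"
    by (metis linorder_less_linear)
  define k where "k = 1 - v 0 - p (-1) 0 * exp (-x)"
  have Vk: "?V x y = v (-1) * exp (-y) + v 1 * exp y - k" for y
    using p0 by (simp add: boundary_fun_def atLeastAtMost_m1_1 k_def)
  have "v (-1) = 0 \<and> v 1 = 0"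
    using V[OF y(1)] Vy[OF y(1)] Vy[OF y(2)] y(3) pos[OF y(1)] nn(2)[of 0]
    by (intro exp_three_points[of _ _ 0 y y' k]) (auto simp: Vk)
  then show False using v nv by auto
qed

lemma no_sign_balanced_set:
  assumes qp: "quarter_plane_boundary p v" "quarter_plane_boundary (\<lambda>s t. p t s) h"
    and bal: "sign_balanced p v G" "sign_balanced (\<lambda>s t. p t s) h (G\<inverse>)"
    and pos: "\<And>x y. (x, y) \<in> G \<Longrightarrow> 0 < x \<and> 0 < y \<and> kernel_fun p x y = 1"
    and moves: "\<exists>s\<in>{-1..1}. \<exists>t\<in>{-1..1}. (s, t) \<noteq> (0, 0) \<and> p s t \<noteq> 0"
    and v: "vertical_moves p \<or> v 1 \<noteq> 0 \<or> v (-1) \<noteq> 0"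
    and h: "vertical_moves (\<lambda>s t. p t s) \<or> h 1 \<noteq> 0 \<or> h (-1) \<noteq> 0"
    and "finite G" "G \<noteq> {}"
    and coupled: "\<And>z. z \<in> G \<Longrightarrow> \<exists>z'\<in>G. z' \<noteq> z \<and> (fst z' = fst z \<or> snd z' = snd z)"
  shows False
proof -
  have swap: "kernel_fun (\<lambda>s t. p t s) y x = kernel_fun p x y" for x y
    unfolding kernel_fun_def by (subst sum.swap) (simp add: add.commute)
  have pos': "0 < y \<and> 0 < x \<and> kernel_fun (\<lambda>s t. p t s) y x = 1" if "(y, x) \<in> G\<inverse>" for x y
    using pos that swap by auto
  obtain z z' where zz: "z \<in> G" "z' \<in> G" "z \<noteq> z'" using \<open>G \<noteq> {}\<close> coupled by blast
  have pm: "vertical_moves p"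
    by (rule vertical_moves_if_balanced[OF qp(1) bal(1) pos zz moves v])
  have swap_zz: "prod.swap z \<in> G\<inverse>" "prod.swap z' \<in> G\<inverse>" "prod.swap z \<noteq> prod.swap z'"
    using zz by (cases z; cases z'; auto)+
  have pm': "vertical_moves (\<lambda>s t. p t s)"
    by (rule vertical_moves_if_balanced[OF qp(2) bal(2) pos' swap_zz _ h]) (use moves in blast)+
  define y where "y = Min (snd ` G)"
  have min: "y \<le> b" if "(a, b) \<in> G" for a b
    unfolding y_def using \<open>finite G\<close> that by (intro Min_le) (auto intro: rev_image_eqI)
  have "y \<in> snd ` G" unfolding y_def using \<open>finite G\<close> \<open>G \<noteq> {}\<close> by (intro Min_in) auto
  then obtain x where x: "(x, y) \<in> G" by auto
  show False
  proof (cases "\<forall>x'. (x', y) \<in> G \<longrightarrow> x' = x")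
    case True
    obtain a b where ab: "(a, b) \<in> G" "(a, b) \<noteq> (x, y)" "a = x \<or> b = y"
      using coupled[OF x] by force
    then have "a = x" using True by blast
    then have "(x, b) \<in> G" "y < b" using ab min[of a b] by auto
    then show False
      using no_lower_end[where G = G, OF qp(1) pm bal(1) pos x] True by metis
  next
    case False
    then obtain a b where ab: "(a, y) \<in> G" "(b, y) \<in> G" "a < b"
      using x by (metis linorder_less_linear)
    note a = pos[OF ab(1)] and b = pos[OF ab(2)]
    \<comment> \<open>The point \<open>(b, y)\<close> lies to the right of \<open>(a, y)\<close>, so
      nothing can lie above the latter. After exchanging the axes, \<open>(y, a)\<close> is alone at
      height \<open>a\<close> and has \<open>(y, b)\<close> above it.\<close>
    have "\<not> y < y'" if "(a, y') \<in> G" for y'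
      using no_kernel_point_to_the_right[OF qp(1) pm, of a b y y'] a b ab(3) pos[OF that] by auto
    then have single: "y' = y" if "(a, y') \<in> G" for y'
      using min that by (metis order_le_less)
    have "(y, a) \<in> G\<inverse>" "(y, b) \<in> G\<inverse>" using ab by auto
    then show False
      using no_lower_end[where G = "G\<inverse>" and x = y and y = a and y' = b, OF qp(2) pm' bal(2)]
        pos' single ab(3) by (metis converseD)
  qed
qed

section \<open>From the balance equation to sign conditions\<close>

text \<open>Only positive exponents occur, because the balance equation is available for \<open>j > 0\<close> only;
  this is why \<open>0\<close> is excluded.\<close>
lemma power_sums_eq_0_imp_coeffs_eq_0:
  fixes f :: "real \<Rightarrow> real"
  assumes "finite S" "0 \<notin> S" "\<And>j. (\<Sum>b\<in>S. f b * b ^ Suc j) = 0" "b \<in> S"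
  shows "f b = 0"
  using assms
proof (induction S arbitrary: f b rule: finite_induct)
  case (insert c S)
  \<comment> \<open>Subtracting \<open>c\<close> times the sum at \<open>j\<close> from the sum at
    \<open>j + 1\<close> eliminates the base \<open>c\<close>.\<close>
  have step: "f b * (b - c) = 0" if "b \<in> S" for b
  proof (rule insert.IH[where f = "\<lambda>b. f b * (b - c)"])
    fix j
    have "(\<Sum>b\<in>S. f b * (b - c) * b ^ Suc j) =
        (\<Sum>b\<in>insert c S. f b * b ^ Suc (Suc j)) - c * (\<Sum>b\<in>insert c S. f b * b ^ Suc j)"
      using insert.hyps by (simp add: sum_distrib_left sum_subtractf algebra_simps)
    then show "(\<Sum>b\<in>S. f b * (b - c) * b ^ Suc j) = 0"
      unfolding insert.prems(2) by simp
  qed (use insert that in auto)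
  then have S: "f b = 0" if "b \<in> S" for b using that insert.hyps by force
  then have "f c * c = 0" using insert.prems(2)[of 0] insert.hyps by simp
  then show ?case using S insert.prems by auto
qed simp

text \<open>Inserting the sum of geometric terms into the balance equation and grouping by \<sigma>
  gives a vanishing combination of powers of distinct bases. Each group therefore vanishes, and its
  positive weights rule out nonzero values of one sign only.\<close>

lemma sign_balanced_if_boundary_balance:
  fixes m :: "nat \<Rightarrow> nat \<Rightarrow> real"
  assumes "finite G" and w: "\<And>z. z \<in> G \<Longrightarrow> w z > 0"
    and m: "\<And>i j. m i j = (\<Sum>z\<in>G. w z * exp (- fst z) ^ i * exp (- snd z) ^ j)"
    and bal: "\<And>j. j > 0 \<Longrightarrow> m 0 j =
        (\<Sum>t=-1..1. m 1 (nat (int j - t)) * p (-1) t) + (\<Sum>t=-1..1. m 0 (nat (int j - t)) * v t)"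
  shows "sign_balanced p v G"
proof -
  let ?V = "\<lambda>z. boundary_fun p v (fst z) (snd z)"
  define g where "g b = (\<Sum>z\<in>{z\<in>G. exp (- snd z) = b}. w z * ?V z)" for b
  have V: "exp (- snd z) ^ Suc j * ?V z =
      exp (- fst z) * (p (-1) (-1) * exp (- snd z) ^ Suc (Suc j) + p (-1) 0 * exp (- snd z) ^ Suc j
        + p (-1) 1 * exp (- snd z) ^ j)
      + (v (-1) * exp (- snd z) ^ Suc (Suc j) + v 0 * exp (- snd z) ^ Suc j + v 1 * exp (- snd z) ^ j)
      - exp (- snd z) ^ Suc j" for z :: "real \<times> real" and j
    by (simp add: boundary_fun_def atLeastAtMost_m1_1 exp_add exp_diff exp_minus field_simps)
  have "(\<Sum>b\<in>(\<lambda>z. exp (- snd z)) ` G. g b * b ^ Suc j) = 0" for j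
  proof -
    have "(\<Sum>b\<in>(\<lambda>z. exp (- snd z)) ` G. g b * b ^ Suc j) =
       (\<Sum>b\<in>(\<lambda>z. exp (- snd z)) ` G. \<Sum>z\<in>{z\<in>G. exp (- snd z) = b}.
          w z * (exp (- snd z) ^ Suc j * ?V z))"
      unfolding g_def sum_distrib_right by (intro sum.cong) auto
    also have "\<dots> = (\<Sum>z\<in>G. w z * (exp (- snd z) ^ Suc j * ?V z))"
      using \<open>finite G\<close> by (rule sum.image_gen[symmetric])
    also have "\<dots> = m 1 (Suc (Suc j)) * p (-1) (-1) + m 1 (Suc j) * p (-1) 0 + m 1 j * p (-1) 1
       + (m 0 (Suc (Suc j)) * v (-1) + m 0 (Suc j) * v 0 + m 0 j * v 1) - m 0 (Suc j)"
      unfolding V m sum_distrib_right sum.distrib[symmetric] sum_subtractf[symmetric]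
      by (intro sum.cong) (simp_all add: algebra_simps)
    also have "\<dots> = 0"
      using bal[of "Suc j"] by (simp add: atLeastAtMost_m1_1 nat_add_distrib)
    finally show ?thesis .
  qed
  then have g: "g b = 0" if "b \<in> (\<lambda>z. exp (- snd z)) ` G" for b
    using that \<open>finite G\<close> by (intro power_sums_eq_0_imp_coeffs_eq_0[where f = g]) auto
  have sum0: "(\<Sum>z\<in>{z\<in>G. snd z = y}. w z * ?V z) = 0" if "(x, y) \<in> G" for x y
    using g[of "exp (-y)"] that unfolding g_def by (force simp: image_iff)
  have sum_pos: "(\<Sum>z\<in>{z\<in>G. snd z = y}. w z * f z) > 0"
    if "(x, y) \<in> G" "f (x, y) > 0" "\<And>x'. (x', y) \<in> G \<Longrightarrow> f (x', y) \<ge> 0" for f x y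
  proof (rule sum_pos2)
    show "0 \<le> w z * f z" if "z \<in> {z\<in>G. snd z = y}" for z
      using that w[of z] \<open>\<And>x'. (x', y) \<in> G \<Longrightarrow> f (x', y) \<ge> 0\<close>
      by (cases z) (auto intro!: mult_nonneg_nonneg less_imp_le)
  qed (use that w \<open>finite G\<close> in auto)
  show ?thesis unfolding sign_balanced_def
  proof (intro allI impI conjI)
    fix x y assume xy: "(x, y) \<in> G" "boundary_fun p v x y > 0"
    show "\<exists>x'. (x', y) \<in> G \<and> boundary_fun p v x' y < 0"
    proof (rule ccontr)
      assume "\<not> ?thesis"
      then have "(\<Sum>z\<in>{z\<in>G. snd z = y}. w z * ?V z) > 0"
        using xy by (intro sum_pos) (auto simp: not_less)
      then show False using sum0[OF xy(1)] by simp
    qed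
  next
    fix x y assume xy: "(x, y) \<in> G" "boundary_fun p v x y < 0"
    show "\<exists>x'. (x', y) \<in> G \<and> boundary_fun p v x' y > 0"
    proof (rule ccontr)
      assume "\<not> ?thesis"
      then have "(\<Sum>z\<in>{z\<in>G. snd z = y}. w z * - ?V z) > 0"
        using xy by (intro sum_pos) (auto simp: not_less)
      then show False using sum0[OF xy(1)] by (simp add: sum_negf)
    qed
  qed
qed

section \<open>Consequences of irreducibility\<close>

lemma irreducible_chain_closed_set:
  assumes "irreducible_chain K" "x \<in> A" "\<And>x y. x \<in> A \<Longrightarrow> y \<in> set_pmf (K x) \<Longrightarrow> y \<in> A"
  shows "y \<in> A"
proof -
  have "set_pmf (n_step K n x) \<subseteq> A" if "x \<in> A" for n x
    using that
  proof (induction n arbitrary: x)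
    case (Suc n)
    then show ?case using assms(3) by fastforce
  qed simp
  moreover obtain n where "pmf (n_step K n x) y > 0"
    using assms(1) by (auto simp: irreducible_chain_def)
  ultimately show ?thesis using assms(2) by (auto simp: pmf_positive_iff)
qed

lemma qp_walk_closed_set:
  assumes "qp_random_walk p h v" "x \<in> A"
    and "\<And>x y. x \<in> A \<Longrightarrow> qp_trans p h v x y \<noteq> 0 \<Longrightarrow> y \<in> A"
  shows "y \<in> A"
proof (rule irreducible_chain_closed_set[OF _ assms(2)])
  show "irreducible_chain (qp_kernel p h v)" using assms(1) by (simp add: qp_random_walk_def)
  show "b \<in> A" if "a \<in> A" "b \<in> set_pmf (qp_kernel p h v a)" for a b
    using assms that by (auto simp: set_pmf_iff pmf_qp_kernel qp_random_walk_def)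
qed

text \<open>Otherwise the interior state \<open>(1, 1)\<close> would be absorbing.\<close>

lemma qp_walk_moves:
  assumes "qp_random_walk p h v"
  shows "\<exists>s\<in>{-1..1}. \<exists>t\<in>{-1..1}. (s, t) \<noteq> (0, 0) \<and> p s t \<noteq> 0"
proof (rule ccontr)
  assume no: "\<not> ?thesis"
  have "(0, 0) \<in> {(1, 1) :: nat \<times> nat}"
  proof (rule qp_walk_closed_set[OF assms, of "(1, 1)"])
    fix x y :: "nat \<times> nat"
    assume x: "x \<in> {(1, 1)}" and nz: "qp_trans p h v x y \<noteq> 0"
    obtain k l where y: "y = (k, l)" by (cases y)
    have "int k - 1 \<in> {-1..1}" "int l - 1 \<in> {-1..1}" "p (int k - 1) (int l - 1) \<noteq> 0"
      using x nz by (auto simp: y Let_def split: if_splits)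
    then have "(int k - 1, int l - 1) = (0, 0)" using no by blast
    then show "y \<in> {(1, 1)}" by (simp add: y)
  qed simp
  then show False by simp
qed

text \<open>Otherwise the walk could never leave the horizontal axis.\<close>

lemma qp_walk_vertical_moves:
  assumes "qp_random_walk p h v"
  shows "vertical_moves p \<or> v 1 \<noteq> 0 \<or> v (-1) \<noteq> 0"
proof (rule ccontr)
  assume "\<not> ?thesis"
  then have up: "p s 1 = 0" "v 1 = 0" if "s \<in> {-1..1}" for s
    using that by (auto simp: vertical_moves_def)
  have "(0, 1) \<in> {(i :: nat, j :: nat). j = 0}"
  proof (rule qp_walk_closed_set[OF assms, of "(0, 0)"])
    fix x y :: "nat \<times> nat"
    assume x: "x \<in> {(i, j). j = 0}" and nz: "qp_trans p h v x y \<noteq> 0"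
    obtain i k l where xy: "x = (i, 0)" "y = (k, l)" using x by (cases x; cases y) auto
    have "qp_trans p h v (i, 0) (k, l) = 0" if "l \<noteq> 0"
      using that up[of "int k - int i"] up[of 0] up[of 1] by (cases "l = 1") (auto simp: Let_def)
    then show "y \<in> {(i, j). j = 0}" using nz xy by auto
  qed simp
  then show False by simp
qed

lemma qp_walk_horizontal_moves:
  assumes "qp_random_walk p h v"
  shows "vertical_moves (\<lambda>s t. p t s) \<or> h 1 \<noteq> 0 \<or> h (-1) \<noteq> 0"
proof (rule ccontr)
  assume "\<not> ?thesis"
  then have right: "p 1 t = 0" "h 1 = 0" if "t \<in> {-1..1}" for t
    using that by (auto simp: vertical_moves_def)
  have "(1, 0) \<in> {(i :: nat, j :: nat). i = 0}"
  proof (rule qp_walk_closed_set[OF assms, of "(0, 0)"])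
    fix x y :: "nat \<times> nat"
    assume x: "x \<in> {(i, j). i = 0}" and nz: "qp_trans p h v x y \<noteq> 0"
    obtain j k l where xy: "x = (0, j)" "y = (k, l)" using x by (cases x; cases y) auto
    have "qp_trans p h v (0, j) (k, l) = 0" if "k \<noteq> 0"
      using that right[of "int l - int j"] right[of 0] right[of 1] by (cases "k = 1") (auto simp: Let_def)
    then show "y \<in> {(i, j). i = 0}" using nz xy by auto
  qed simp
  then show False by simp
qed

section \<open>Coupling and logarithmic coordinates\<close>

text \<open>An isolated point could be split off as a block of its own, giving an uncoupled
  partition with two blocks.\<close>

lemma pairwise_coupled_no_isolated_point:
  assumes "pairwise_coupled \<Gamma>" "card \<Gamma> \<ge> 2" "z \<in> \<Gamma>"
  shows "\<exists>z'\<in>\<Gamma>. z' \<noteq> z \<and> (fst z' = fst z \<or> snd z' = snd z)"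
proof (rule ccontr)
  assume iso: "\<not> ?thesis"
  let ?Q = "{{z}, \<Gamma> - {z}}"
  have ne: "\<Gamma> - {z} \<noteq> {}" using assms(2,3) by (auto simp: subset_singleton_iff)
  have "partition_on \<Gamma> ?Q"
    using ne assms(3) by (auto simp: partition_on_def disjoint_def)
  moreover have "(a = {z} \<and> b = \<Gamma> - {z}) \<or> (b = {z} \<and> a = \<Gamma> - {z})"
    if "a \<in> ?Q" "b \<in> ?Q" "a \<noteq> b" for a b using that by auto
  ultimately have "uncoupled_partition \<Gamma> ?Q"
    unfolding uncoupled_partition_def using iso by (fastforce split: prod.splits)
  moreover obtain P where "maximal_uncoupled_partition \<Gamma> P" "card P = 1"
    using assms(1) by (auto simp: pairwise_coupled_def)
  ultimately have P: "?Q \<lesssim> P" "card P = 1"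
    unfolding maximal_uncoupled_partition_def by blast+
  then have "card ?Q \<le> 1" using lepoll_iff_card_le[of ?Q P] by (simp add: card_ge_0_finite)
  moreover have "{z} \<noteq> \<Gamma> - {z}" by auto
  ultimately show False by simp
qed

lemma qp_Q_exp:
  "qp_Q p (exp (-x)) (exp (-y)) = exp (-x) * exp (-y) * (kernel_fun p x y - 1)"
proof -
  have "exp (-x) * exp x = 1" "exp (-y) * exp y = 1" by (simp_all flip: exp_add)
  then have summand: "exp (-x) ^ nat (1 - s) * exp (-y) ^ nat (1 - t)
      = exp (-x) * exp (-y) * exp (of_int s * x + of_int t * y)"
    if "s \<in> {-1..1}" "t \<in> {-1..1}" for s t
    using that
    by (auto simp: atLeastAtMost_m1_1 exp_add exp_diff exp_minus power2_eq_square field_simps)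
  have "(\<Sum>s=-1..1. \<Sum>t=-1..1. exp (-x) ^ nat (1 - s) * exp (-y) ^ nat (1 - t) * p s t)
      = exp (-x) * exp (-y) * kernel_fun p x y"
    unfolding kernel_fun_def sum_distrib_left
    by (intro sum.cong refl) (simp only: summand, simp only: mult_ac)
  then show ?thesis by (simp add: qp_Q_def algebra_simps)
qed

theorem theorem5:
  fixes p :: "int \<Rightarrow> int \<Rightarrow> real" and h v :: "int \<Rightarrow> real"
    and m :: "nat \<Rightarrow> nat \<Rightarrow> real"
    and \<Gamma> :: "(real \<times> real) set" and \<alpha> :: "real \<Rightarrow> real \<Rightarrow> real"
  assumes "qp_random_walk p h v"
    and "invariant_measure p h v m"
    and "finite \<Gamma>" and "\<Gamma> \<subseteq> qp_C p"
    and "card \<Gamma> \<ge> 2"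
    and "\<forall>(\<rho>, \<sigma>)\<in>\<Gamma>. \<alpha> \<rho> \<sigma> \<noteq> 0"
    and "\<forall>i j. m i j = (\<Sum>(\<rho>, \<sigma>)\<in>\<Gamma>. \<alpha> \<rho> \<sigma> * \<rho> ^ i * \<sigma> ^ j)"
    and "pairwise_coupled \<Gamma>"
    and "\<forall>(\<rho>, \<sigma>)\<in>\<Gamma>. \<rho> > 0 \<and> \<sigma> > 0"
  shows "\<exists>(\<rho>, \<sigma>)\<in>\<Gamma>. \<alpha> \<rho> \<sigma> < 0"
proof (rule ccontr)
  assume neg: "\<not> ?thesis"
  have \<alpha>: "\<alpha> \<rho> \<sigma> > 0" if "(\<rho>, \<sigma>) \<in> \<Gamma>" for \<rho> \<sigma>
    using neg assms(6) that by (fastforce simp: not_less less_le)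
  \<comment> \<open>\<Gamma> in logarithmic coordinates; the map is onto because \<rho> and \<sigma>
    are positive.\<close>
  define G where "G = {(x, y). (exp (-x), exp (-y)) \<in> \<Gamma>}"
  define w where "w = (\<lambda>(x, y). \<alpha> (exp (-x)) (exp (-y)))"
  let ?e = "\<lambda>(x, y). (exp (-x), exp (-y)) :: real \<times> real"
  have bij: "bij_betw ?e G \<Gamma>"
    using assms(9)
    by (intro bij_betwI[of _ _ _ "\<lambda>(\<rho>, \<sigma>). (- ln \<rho>, - ln \<sigma>)"]) (auto simp: G_def)
  have "finite G" using bij_betw_finite[OF bij] assms(3) by simp
  have "G \<noteq> {}" using bij_betw_same_card[OF bij] assms(5) by auto
  have m: "m i j = (\<Sum>z\<in>G. w z * exp (- fst z) ^ i * exp (- snd z) ^ j)" for i j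
    unfolding assms(7)[rule_format] w_def
    by (subst sum.reindex_bij_betw[OF bij, symmetric]) (simp add: case_prod_beta)
  have w: "w z > 0" if "z \<in> G" for z using that \<alpha> by (auto simp: G_def w_def)
  have pos: "0 < x \<and> 0 < y \<and> kernel_fun p x y = 1" if "(x, y) \<in> G" for x y
    using assms(4) that by (auto simp: G_def qp_C_def qp_Q_exp)
  have params: "qp_params p h v" using assms(1) by (simp add: qp_random_walk_def)
  have qp1: "quarter_plane_boundary p v"
    using params by (simp add: qp_params_def quarter_plane_boundary_def)
  have qp2: "quarter_plane_boundary (\<lambda>s t. p t s) h"
    using params sum.swap[of p "{-1..1}" "{-1..1}"]
    by (simp add: qp_params_def quarter_plane_boundary_def)
  have inv: "m 0 j = (\<Sum>t=-1..1. m 1 (nat (int j - t)) * p (-1) t) +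
      (\<Sum>t=-1..1. m 0 (nat (int j - t)) * v t)"
    "m j 0 = (\<Sum>s=-1..1. m (nat (int j - s)) 1 * p s (-1)) +
      (\<Sum>s=-1..1. m (nat (int j - s)) 0 * h s)" if "j > 0" for j
    using assms(2) that unfolding invariant_measure_def by blast+
  have bal1: "sign_balanced p v G"
    using inv(1) by (intro sign_balanced_if_boundary_balance[OF \<open>finite G\<close> w m]) auto
  \<comment> \<open>The horizontal axis is treated by reflecting the points and transposing
    \<open>m\<close> and \<open>p\<close>.\<close>
  have conv: "G\<inverse> = prod.swap ` G" by force
  have m': "m j i = (\<Sum>z\<in>G\<inverse>. (w \<circ> prod.swap) z * exp (- fst z) ^ i * exp (- snd z) ^ j)" for i j
    unfolding m conv by (subst sum.reindex) (auto simp: mult_ac intro!: sum.cong)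
  have bal2: "sign_balanced (\<lambda>s t. p t s) h (G\<inverse>)"
    using \<open>finite G\<close> w inv(2)
    by (intro sign_balanced_if_boundary_balance[where m = "\<lambda>i j. m j i", OF _ _ m']) auto
  have coupled: "\<exists>z'\<in>G. z' \<noteq> z \<and> (fst z' = fst z \<or> snd z' = snd z)" if "z \<in> G" for z
  proof -
    have "?e z \<in> \<Gamma>" using that by (auto simp: G_def)
    then obtain a where a: "a \<in> \<Gamma>" "a \<noteq> ?e z" "fst a = fst (?e z) \<or> snd a = snd (?e z)"
      using pairwise_coupled_no_isolated_point[OF assms(8,5)] by blast
    then obtain z' where "z' \<in> G" "a = ?e z'"
      using bij by (auto simp: bij_betw_def)
    then show ?thesis using a by (intro bexI[of _ z']) (auto simp: case_prod_beta)
  qed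
  show False
    by (rule no_sign_balanced_set[OF qp1 qp2 bal1 bal2 pos qp_walk_moves[OF assms(1)]
        qp_walk_vertical_moves[OF assms(1)] qp_walk_horizontal_moves[OF assms(1)]
        \<open>finite G\<close> \<open>G \<noteq> {}\<close> coupled])
qed

end
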